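(* Let $\beta,\gamma,\delta>0$, $\alpha=\beta+\gamma+\delta$, and $x,y,z\in(0,1)$. Let $U_{00},U_{01},U_{10},U_{11}$ be the means and $P,Q,R,S,T,V$ the propositions defined in the context. Then $$\min\{\sin^{\alpha}(\pi U_{00}),\sin^{\alpha}(\pi U_{01}),\sin^{\alpha}(\pi U_{10}),\sin^{\alpha}(\pi U_{11})\}=\begin{cases}\sin^{\alpha}(\pi U_{00}),&\text{if }\neg P,\ \neg Q,\ \neg R\text{ hold},\\ \sin^{\alpha}(\pi U_{01}),&\text{if }P,\ \neg S,\ \neg T\text{ hold},\\ \sin^{\alpha}(\pi U_{10}),&\text{if }Q,\ S,\ \neg V\text{ hold},\\ \sin^{\alpha}(\pi U_{11}),&\text{if }V,\ T,\ R\text{ hold}.\end{cases}$$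
   Context: The means are $$U_{00}=\frac{\beta x+\gamma y+\delta z}{\alpha},\quad U_{01}=\frac{\beta x+\gamma y+\delta(1-z)}{\alpha},\quad U_{10}=\frac{\beta x+\gamma(1-y)+\delta z}{\alpha},\quad U_{11}=\frac{\beta(1-x)+\gamma y+\delta z}{\alpha}.$$ The propositions are \begin{align*} P&:\ (2z-1)(\beta(2x-1)+\gamma(2y-1))\leq0,\\ Q&:\ (2y-1)(\beta(2x-1)+\delta(2z-1))\leq0,\\ R&:\ (2x-1)(\gamma(2y-1)+\delta(2z-1))\leq0,\\ S&:\ (2x-1)(\gamma(2y-1)+\delta(1-2z))\leq0,\\ T&:\ (2y-1)(\beta(2x-1)+\delta(1-2z))\leq0,\\ V&:\ (2z-1)(\beta(2x-1)+\gamma(1-2y))\leq0, \end{align*} and $\neg$ denotes negation. Here $\sin^{c}(t)$ denotes $(\sin t)^c$. *)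

theory Defs
  imports Complex_Main
begin

definition U00 :: "real \<Rightarrow> real \<Rightarrow> real \<Rightarrow> real \<Rightarrow> real \<Rightarrow> real \<Rightarrow> real \<Rightarrow> real" where
  "U00 \<alpha> \<beta> \<gamma> \<delta> x y z = (\<beta> * x + \<gamma> * y + \<delta> * z) / \<alpha>"

definition U01 :: "real \<Rightarrow> real \<Rightarrow> real \<Rightarrow> real \<Rightarrow> real \<Rightarrow> real \<Rightarrow> real \<Rightarrow> real" where
  "U01 \<alpha> \<beta> \<gamma> \<delta> x y z = (\<beta> * x + \<gamma> * y + \<delta> * (1 - z)) / \<alpha>"

definition U10 :: "real \<Rightarrow> real \<Rightarrow> real \<Rightarrow> real \<Rightarrow> real \<Rightarrow> real \<Rightarrow> real \<Rightarrow> real" where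
  "U10 \<alpha> \<beta> \<gamma> \<delta> x y z = (\<beta> * x + \<gamma> * (1 - y) + \<delta> * z) / \<alpha>"

definition U11 :: "real \<Rightarrow> real \<Rightarrow> real \<Rightarrow> real \<Rightarrow> real \<Rightarrow> real \<Rightarrow> real \<Rightarrow> real" where
  "U11 \<alpha> \<beta> \<gamma> \<delta> x y z = (\<beta> * (1 - x) + \<gamma> * y + \<delta> * z) / \<alpha>"

text \<open>All six propositions take the full parameter list for uniformity, although each of them
  involves only two of the weights.\<close>

definition propP :: "real \<Rightarrow> real \<Rightarrow> real \<Rightarrow> real \<Rightarrow> real \<Rightarrow> real \<Rightarrow> bool" where
  "propP \<beta> \<gamma> \<delta> x y z \<longleftrightarrow> (2 * z - 1) * (\<beta> * (2 * x - 1) + \<gamma> * (2 * y - 1)) \<le> 0"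

definition propQ :: "real \<Rightarrow> real \<Rightarrow> real \<Rightarrow> real \<Rightarrow> real \<Rightarrow> real \<Rightarrow> bool" where
  "propQ \<beta> \<gamma> \<delta> x y z \<longleftrightarrow> (2 * y - 1) * (\<beta> * (2 * x - 1) + \<delta> * (2 * z - 1)) \<le> 0"

definition propR :: "real \<Rightarrow> real \<Rightarrow> real \<Rightarrow> real \<Rightarrow> real \<Rightarrow> real \<Rightarrow> bool" where
  "propR \<beta> \<gamma> \<delta> x y z \<longleftrightarrow> (2 * x - 1) * (\<gamma> * (2 * y - 1) + \<delta> * (2 * z - 1)) \<le> 0"

definition propS :: "real \<Rightarrow> real \<Rightarrow> real \<Rightarrow> real \<Rightarrow> real \<Rightarrow> real \<Rightarrow> bool" where
  "propS \<beta> \<gamma> \<delta> x y z \<longleftrightarrow> (2 * x - 1) * (\<gamma> * (2 * y - 1) + \<delta> * (1 - 2 * z)) \<le> 0"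

definition propT :: "real \<Rightarrow> real \<Rightarrow> real \<Rightarrow> real \<Rightarrow> real \<Rightarrow> real \<Rightarrow> bool" where
  "propT \<beta> \<gamma> \<delta> x y z \<longleftrightarrow> (2 * y - 1) * (\<beta> * (2 * x - 1) + \<delta> * (1 - 2 * z)) \<le> 0"

definition propV :: "real \<Rightarrow> real \<Rightarrow> real \<Rightarrow> real \<Rightarrow> real \<Rightarrow> real \<Rightarrow> bool" where
  "propV \<beta> \<gamma> \<delta> x y z \<longleftrightarrow> (2 * z - 1) * (\<beta> * (2 * x - 1) + \<gamma> * (1 - 2 * y)) \<le> 0"

text \<open>\<open>sin_pow c t\<close> is $(\sin t)^c$ with a real exponent.  Here it is only used at
  \<open>t = pi * U\<close> with \<open>0 < U < 1\<close>, where \<open>sin t > 0\<close>, so \<open>powr\<close> is the genuine real power.\<close>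

definition sin_pow :: "real \<Rightarrow> real \<Rightarrow> real" where
  "sin_pow c t = sin t powr c"

end

theory Submission
  imports Defs
begin

text \<open>The function \<open>t \<mapsto> sin (pi * t)\<close> is symmetric about \<open>1/2\<close> and decreases with the distance from
  \<open>1/2\<close> on the unit interval. With \<open>a = \<beta>(2x - 1)\<close>, \<open>b = \<gamma>(2y - 1)\<close>, \<open>c = \<delta>(2z - 1)\<close>, the deviations
  of the means from \<open>1/2\<close> are \<open>1/(2\<alpha>)\<close> times \<open>a + b + c\<close>, \<open>a + b - c\<close>, \<open>a - b + c\<close> and
  \<open>-a + b + c\<close>. The differences of their squares factor, as in
  \<open>(a + b + c)\<^sup>2 - (a + b - c)\<^sup>2 = 4c(a + b)\<close>, so each of the six propositions is exactly one
  pairwise comparison of the four values. The cases pick the minimiser, ties going to the last.\<close>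

text \<open>On (0,1) the sine is positive, so \<open>powr\<close> with a positive exponent preserves
  and reflects order. What is left compares distances from 1/2. These are stated as squares, without
  absolute values, so that their difference can be factored.\<close>

lemma sin_pow_le_iff:
  fixes c u v :: real
  assumes "c > 0" and u: "u \<in> {0<..<1}" and v: "v \<in> {0<..<1}"
  shows "sin_pow c (pi * u) \<le> sin_pow c (pi * v) \<longleftrightarrow> (2 * v - 1)\<^sup>2 \<le> (2 * u - 1)\<^sup>2"
proof -
  \<comment> \<open>The absolute value puts the argument in [0, pi], where cosine is strictly
    decreasing; this handles both sides of 1/2 at once.\<close>
  have cos_form: "sin (pi * t) = cos (pi * \<bar>t - 1/2\<bar>)" for t :: real
  proof -
    have "sin (pi * t) = cos (pi * (t - 1/2))"
      by (simp add: right_diff_distrib cos_diff)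
    also have "\<dots> = cos (pi * \<bar>t - 1/2\<bar>)"
      by (metis abs_mult cos_abs_real abs_of_pos pi_gt_zero)
    finally show ?thesis .
  qed
  have pos: "sin (pi * t) > 0" if "t \<in> {0<..<1}" for t :: real
    using that by (intro sin_gt_zero) auto
  have range: "0 \<le> pi * \<bar>t - 1/2\<bar>" "pi * \<bar>t - 1/2\<bar> \<le> pi" if "t \<in> {0<..<1}" for t :: real
    using that by (auto simp: abs_if)
  have "sin_pow c (pi * u) \<le> sin_pow c (pi * v) \<longleftrightarrow> sin (pi * u) \<le> sin (pi * v)"
    using pos[OF u] pos[OF v] \<open>c > 0\<close> unfolding sin_pow_def
    by (meson less_eq_real_def not_less powr_less_mono2 powr_mono2)
  also have "\<dots> \<longleftrightarrow> pi * \<bar>v - 1/2\<bar> \<le> pi * \<bar>u - 1/2\<bar>"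
    unfolding cos_form using range[OF u] range[OF v] by (intro cos_mono_le_eq) auto
  also have "\<dots> \<longleftrightarrow> \<bar>2 * v - 1\<bar> \<le> \<bar>2 * u - 1\<bar>"
    by (auto simp: abs_if)
  finally show ?thesis
    by (simp add: abs_le_square_iff)
qed

lemma weighted_mean_in_unit_interval:
  fixes \<beta> \<gamma> \<delta> x y z :: real
  assumes "\<beta> > 0" "\<gamma> > 0" "\<delta> > 0" "x \<in> {0<..<1}" "y \<in> {0<..<1}" "z \<in> {0<..<1}"
  shows "(\<beta> * x + \<gamma> * y + \<delta> * z) / (\<beta> + \<gamma> + \<delta>) \<in> {0<..<1}"
proof -
  have "\<beta> * x < \<beta>" "\<gamma> * y < \<gamma>" "\<delta> * z < \<delta>" "0 < \<beta> * x" "0 < \<gamma> * y" "0 < \<delta> * z"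
    using assms by auto
  then have "0 < \<beta> * x + \<gamma> * y + \<delta> * z" "\<beta> * x + \<gamma> * y + \<delta> * z < \<beta> + \<gamma> + \<delta>"
    by linarith+
  then show ?thesis
    by simp
qed

text \<open>A difference of squares: the two factors are 2(p - q)/\<alpha> and 2(p + q -
  \<alpha>)/\<alpha>, and 4/\<alpha>^2 > 0 does not affect the sign.\<close>

lemma square_weighted_mean_le_iff:
  fixes \<alpha> p q :: real
  assumes "\<alpha> > 0"
  shows "(2 * (p / \<alpha>) - 1)\<^sup>2 \<le> (2 * (q / \<alpha>) - 1)\<^sup>2 \<longleftrightarrow> (p - q) * (p + q - \<alpha>) \<le> 0"
proof -
  have "(2 * (p / \<alpha>) - 1)\<^sup>2 - (2 * (q / \<alpha>) - 1)\<^sup>2 = (4 / \<alpha>\<^sup>2) * ((p - q) * (p + q - \<alpha>))"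
    using assms by (simp add: field_simps power2_eq_square)
  moreover have "(4 / \<alpha>\<^sup>2) * r \<le> 0 \<longleftrightarrow> r \<le> 0" for r :: real
    using assms by (simp add: mult_le_0_iff divide_le_0_iff)
  ultimately show ?thesis
    by (metis diff_le_0_iff_le)
qed

theorem theorem4p1:
  fixes \<alpha> \<beta> \<gamma> \<delta> x y z :: real
  assumes "\<beta> > 0" and "\<gamma> > 0" and "\<delta> > 0"
    and "\<alpha> = \<beta> + \<gamma> + \<delta>"
    and "x \<in> {0<..<1}" and "y \<in> {0<..<1}" and "z \<in> {0<..<1}"
  shows "let s00 = sin_pow \<alpha> (pi * U00 \<alpha> \<beta> \<gamma> \<delta> x y z);
             s01 = sin_pow \<alpha> (pi * U01 \<alpha> \<beta> \<gamma> \<delta> x y z);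
             s10 = sin_pow \<alpha> (pi * U10 \<alpha> \<beta> \<gamma> \<delta> x y z);
             s11 = sin_pow \<alpha> (pi * U11 \<alpha> \<beta> \<gamma> \<delta> x y z);
             P = propP \<beta> \<gamma> \<delta> x y z;
             Q = propQ \<beta> \<gamma> \<delta> x y z;
             R = propR \<beta> \<gamma> \<delta> x y z;
             S = propS \<beta> \<gamma> \<delta> x y z;
             T = propT \<beta> \<gamma> \<delta> x y z;
             V = propV \<beta> \<gamma> \<delta> x y z;
             m = Min {s00, s01, s10, s11}
         in ((\<not> P \<and> \<not> Q \<and> \<not> R) \<longrightarrow> m = s00) \<and>
            ((P \<and> \<not> S \<and> \<not> T) \<longrightarrow> m = s01) \<and>
            ((Q \<and> S \<and> \<not> V) \<longrightarrow> m = s10) \<and>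
            ((V \<and> T \<and> R) \<longrightarrow> m = s11) \<and>
            ((\<not> P \<and> \<not> Q \<and> \<not> R) \<or> (P \<and> \<not> S \<and> \<not> T) \<or> (Q \<and> S \<and> \<not> V) \<or> (V \<and> T \<and> R))"
proof -
  define s00 where "s00 = sin_pow \<alpha> (pi * U00 \<alpha> \<beta> \<gamma> \<delta> x y z)"
  define s01 where "s01 = sin_pow \<alpha> (pi * U01 \<alpha> \<beta> \<gamma> \<delta> x y z)"
  define s10 where "s10 = sin_pow \<alpha> (pi * U10 \<alpha> \<beta> \<gamma> \<delta> x y z)"
  define s11 where "s11 = sin_pow \<alpha> (pi * U11 \<alpha> \<beta> \<gamma> \<delta> x y z)"
  note weights = assms(1-3)
  have \<alpha>: "\<alpha> > 0"
    using assms by simp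
  \<comment> \<open>Each of \<open>U01\<close>, \<open>U10\<close>, \<open>U11\<close> is the plain
    weighted mean with one coordinate reflected, so one bound covers all four.\<close>
  have reflected: "1 - x \<in> {0<..<1}" "1 - y \<in> {0<..<1}" "1 - z \<in> {0<..<1}"
    using assms by auto
  have U: "U00 \<alpha> \<beta> \<gamma> \<delta> x y z \<in> {0<..<1}" "U01 \<alpha> \<beta> \<gamma> \<delta> x y z \<in> {0<..<1}"
    "U10 \<alpha> \<beta> \<gamma> \<delta> x y z \<in> {0<..<1}" "U11 \<alpha> \<beta> \<gamma> \<delta> x y z \<in> {0<..<1}"
    unfolding U00_def U01_def U10_def U11_def assms(4)
    by (intro weighted_mean_in_unit_interval weights assms(5-7) reflected)+
  have P: "propP \<beta> \<gamma> \<delta> x y z \<longleftrightarrow> s01 \<le> s00"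
  proof -
    \<comment> \<open>Subtracting the numerators leaves \<delta>(2z - 1); adding them and removing
      \<alpha> cancels z and leaves \<beta>(2x - 1) + \<gamma>(2y - 1).\<close>
    have "(\<beta> * x + \<gamma> * y + \<delta> * z - (\<beta> * x + \<gamma> * y + \<delta> * (1 - z)))
        * (\<beta> * x + \<gamma> * y + \<delta> * z + (\<beta> * x + \<gamma> * y + \<delta> * (1 - z)) - \<alpha>)
      = \<delta> * ((2 * z - 1) * (\<beta> * (2 * x - 1) + \<gamma> * (2 * y - 1)))"
      unfolding assms(4) by algebra
    then have "s01 \<le> s00 \<longleftrightarrow> \<delta> * ((2 * z - 1) * (\<beta> * (2 * x - 1) + \<gamma> * (2 * y - 1))) \<le> 0"
      \<comment> \<open>Smaller sine means larger deviation, so the sides swap: p is the numerator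
        of \<open>U00\<close> and q that of \<open>U01\<close>.\<close>
      unfolding s00_def s01_def sin_pow_le_iff[OF \<alpha> U(2,1)]
      unfolding U00_def U01_def square_weighted_mean_le_iff[OF \<alpha>]
      by simp
    then show ?thesis
      using weights by (simp add: propP_def mult_le_0_iff)
  qed
  have Q: "propQ \<beta> \<gamma> \<delta> x y z \<longleftrightarrow> s10 \<le> s00"
  proof -
    have "(\<beta> * x + \<gamma> * y + \<delta> * z - (\<beta> * x + \<gamma> * (1 - y) + \<delta> * z))
        * (\<beta> * x + \<gamma> * y + \<delta> * z + (\<beta> * x + \<gamma> * (1 - y) + \<delta> * z) - \<alpha>)
      = \<gamma> * ((2 * y - 1) * (\<beta> * (2 * x - 1) + \<delta> * (2 * z - 1)))"
      unfolding assms(4) by algebra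
    then have "s10 \<le> s00 \<longleftrightarrow> \<gamma> * ((2 * y - 1) * (\<beta> * (2 * x - 1) + \<delta> * (2 * z - 1))) \<le> 0"
      unfolding s00_def s10_def sin_pow_le_iff[OF \<alpha> U(3,1)]
      unfolding U00_def U10_def square_weighted_mean_le_iff[OF \<alpha>]
      by simp
    then show ?thesis
      using weights by (simp add: propQ_def mult_le_0_iff)
  qed
  have R: "propR \<beta> \<gamma> \<delta> x y z \<longleftrightarrow> s11 \<le> s00"
  proof -
    have "(\<beta> * x + \<gamma> * y + \<delta> * z - (\<beta> * (1 - x) + \<gamma> * y + \<delta> * z))
        * (\<beta> * x + \<gamma> * y + \<delta> * z + (\<beta> * (1 - x) + \<gamma> * y + \<delta> * z) - \<alpha>)
      = \<beta> * ((2 * x - 1) * (\<gamma> * (2 * y - 1) + \<delta> * (2 * z - 1)))"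
      unfolding assms(4) by algebra
    then have "s11 \<le> s00 \<longleftrightarrow> \<beta> * ((2 * x - 1) * (\<gamma> * (2 * y - 1) + \<delta> * (2 * z - 1))) \<le> 0"
      unfolding s00_def s11_def sin_pow_le_iff[OF \<alpha> U(4,1)]
      unfolding U00_def U11_def square_weighted_mean_le_iff[OF \<alpha>]
      by simp
    then show ?thesis
      using weights by (simp add: propR_def mult_le_0_iff)
  qed
  have S: "propS \<beta> \<gamma> \<delta> x y z \<longleftrightarrow> s10 \<le> s01"
  proof -
    \<comment> \<open>Neither mean is \<open>U00\<close> now, so two coordinates differ and the
      factors trade roles: the difference gives \<gamma>(2y - 1) + \<delta>(1 - 2z), the sum gives
      \<beta>(2x - 1).\<close>
    have "(\<beta> * x + \<gamma> * y + \<delta> * (1 - z) - (\<beta> * x + \<gamma> * (1 - y) + \<delta> * z))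
        * (\<beta> * x + \<gamma> * y + \<delta> * (1 - z) + (\<beta> * x + \<gamma> * (1 - y) + \<delta> * z) - \<alpha>)
      = \<beta> * ((2 * x - 1) * (\<gamma> * (2 * y - 1) + \<delta> * (1 - 2 * z)))"
      unfolding assms(4) by algebra
    then have "s10 \<le> s01 \<longleftrightarrow> \<beta> * ((2 * x - 1) * (\<gamma> * (2 * y - 1) + \<delta> * (1 - 2 * z))) \<le> 0"
      unfolding s01_def s10_def sin_pow_le_iff[OF \<alpha> U(3,2)]
      unfolding U01_def U10_def square_weighted_mean_le_iff[OF \<alpha>]
      by simp
    then show ?thesis
      using weights by (simp add: propS_def mult_le_0_iff)
  qed
  have T: "propT \<beta> \<gamma> \<delta> x y z \<longleftrightarrow> s11 \<le> s01"
  proof -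
    have "(\<beta> * x + \<gamma> * y + \<delta> * (1 - z) - (\<beta> * (1 - x) + \<gamma> * y + \<delta> * z))
        * (\<beta> * x + \<gamma> * y + \<delta> * (1 - z) + (\<beta> * (1 - x) + \<gamma> * y + \<delta> * z) - \<alpha>)
      = \<gamma> * ((2 * y - 1) * (\<beta> * (2 * x - 1) + \<delta> * (1 - 2 * z)))"
      unfolding assms(4) by algebra
    then have "s11 \<le> s01 \<longleftrightarrow> \<gamma> * ((2 * y - 1) * (\<beta> * (2 * x - 1) + \<delta> * (1 - 2 * z))) \<le> 0"
      unfolding s01_def s11_def sin_pow_le_iff[OF \<alpha> U(4,2)]
      unfolding U01_def U11_def square_weighted_mean_le_iff[OF \<alpha>]
      by simp
    then show ?thesis
      using weights by (simp add: propT_def mult_le_0_iff)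
  qed
  have V: "propV \<beta> \<gamma> \<delta> x y z \<longleftrightarrow> s11 \<le> s10"
  proof -
    have "(\<beta> * x + \<gamma> * (1 - y) + \<delta> * z - (\<beta> * (1 - x) + \<gamma> * y + \<delta> * z))
        * (\<beta> * x + \<gamma> * (1 - y) + \<delta> * z + (\<beta> * (1 - x) + \<gamma> * y + \<delta> * z) - \<alpha>)
      = \<delta> * ((2 * z - 1) * (\<beta> * (2 * x - 1) + \<gamma> * (1 - 2 * y)))"
      unfolding assms(4) by algebra
    then have "s11 \<le> s10 \<longleftrightarrow> \<delta> * ((2 * z - 1) * (\<beta> * (2 * x - 1) + \<gamma> * (1 - 2 * y))) \<le> 0"
      unfolding s10_def s11_def sin_pow_le_iff[OF \<alpha> U(4,3)]
      unfolding U10_def U11_def square_weighted_mean_le_iff[OF \<alpha>]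
      by simp
    then show ?thesis
      using weights by (simp add: propV_def mult_le_0_iff)
  qed
  \<comment> \<open>Only the linear order of four reals remains. Each case asks for <= against
    earlier values and < against later ones, so it selects the last minimiser in the order
    \<open>s00\<close>, \<open>s01\<close>, \<open>s10\<close>, \<open>s11\<close>. One always
    exists, which gives the final disjunction.\<close>
  show ?thesis
    unfolding Let_def P Q R S T V
    unfolding s00_def[symmetric] s01_def[symmetric] s10_def[symmetric] s11_def[symmetric]
    by (auto simp: min_def)
qed

end
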